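(* Let $J,R,Q\in\mathbb{R}^{n\times n}$, where $J$ is skew-symmetric, $R$ is symmetric positive semidefinite and $Q$ is symmetric positive definite. Then the matrix $A := (J-R)Q$ has the following spectral properties: (i) Each eigenvalue of $A$ has non-positive real part. (ii) For all $\alpha\in\mathbb{R}$ we have $\ker(A-i\alpha I_n)=\ker((A-i\alpha I_n)^2)$ (kernels in $\mathbb{C}^n$), i.e. the corresponding Jordan block is diagonal if $i\alpha\in\sigma(A)$, and $$N_{i\alpha}(A)\subset N_{i\alpha}(JQ)\cap\ker(RQ).$$ (iii) There is a $Q$-orthogonal subspace decomposition $\mathbb{R}^n=M_1\oplus_Q M_2$ with respect to which $$JQ=\begin{bmatrix}J_1&0\\0&J_2\end{bmatrix}\quad\text{and}\quad RQ=\begin{bmatrix}0&0\\0&R_2\end{bmatrix},$$ such that $J_1$ and $J_2$ are $Q$-skew-symmetric (on $M_1$ and $M_2$, respectively), $R_2$ is $Q$-positive semidefinite, and $J_2-R_2$ is Hurwitz, i.e. all its eigenvalues have negative real part.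
   Context: For a real matrix $A\in\mathbb{R}^{n\times n}$ and $\lambda\in\mathbb{C}$ set $N_\lambda(A):=\operatorname{span}\{\operatorname{Re}(x),\operatorname{Im}(x): x\in\ker(A-\lambda I_n)\}\subset\mathbb{R}^n$, where the kernel is taken in $\mathbb{C}^n$ and real and imaginary parts are taken componentwise. $\sigma(A)$ is the set of complex eigenvalues of $A$. A linear map is called $Q$-symmetric ($Q$-skew-symmetric, $Q$-positive (semi-)definite) if it has the respective property with respect to the inner product $\langle Q\,\cdot,\cdot\rangle$ on $\mathbb{R}^n$ (or its restriction to the subspace concerned); $\oplus_Q$ denotes a direct sum that is orthogonal with respect to this inner product. In the block matrices, $J_j: M_j\to M_j$ for $j=1,2$, and $R_2:M_2\to M_2$. *)

theory Defs
  imports "HOL-Analysis.Analysis"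
begin

definition cmat :: "real^'n^'m \<Rightarrow> complex^'n^'m" where
  "cmat A = map_matrix complex_of_real A"

definition Re_vec :: "complex^'n \<Rightarrow> real^'n" where
  "Re_vec x = (\<chi> i. Re (x $ i))"

definition Im_vec :: "complex^'n \<Rightarrow> real^'n" where
  "Im_vec x = (\<chi> i. Im (x $ i))"

definition ker :: "'a::comm_ring_1^'n^'m \<Rightarrow> ('a^'n) set" where
  "ker A = {x. A *v x = 0}"

definition eigenvalues :: "real^'n^'n \<Rightarrow> complex set" where
  "eigenvalues A = {\<mu>. \<exists>x. x \<noteq> 0 \<and> cmat A *v x = \<mu> *s x}"

definition N_space :: "complex \<Rightarrow> real^'n^'n \<Rightarrow> (real^'n) set" where
  "N_space \<mu> A = span (\<Union>x \<in> ker (cmat A - mat \<mu>). {Re_vec x, Im_vec x})"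

definition skew_symmetric :: "real^'n^'n \<Rightarrow> bool" where
  "skew_symmetric A \<longleftrightarrow> transpose A = - A"

definition sym_pos_semidef :: "real^'n^'n \<Rightarrow> bool" where
  "sym_pos_semidef A \<longleftrightarrow> transpose A = A \<and> (\<forall>x. 0 \<le> (A *v x) \<bullet> x)"

definition sym_pos_def :: "real^'n^'n \<Rightarrow> bool" where
  "sym_pos_def A \<longleftrightarrow> transpose A = A \<and> (\<forall>x. x \<noteq> 0 \<longrightarrow> 0 < (A *v x) \<bullet> x)"

text \<open>The bijection \<open>f\<close> supplies the order of the rows and columns, since the
  index type is not ordered. Off the diagonal, a Jordan matrix has entries 1 in
  some positions of the first superdiagonal that join equal diagonal entries, and
  0 elsewhere.\<close>

definition jordan_matrix :: "complex^'n^'n \<Rightarrow> bool" where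
  "jordan_matrix B \<longleftrightarrow> (\<exists>f :: 'n \<Rightarrow> nat. bij_betw f UNIV {..<CARD('n)} \<and>
     (\<forall>i j. i \<noteq> j \<longrightarrow> B $ i $ j \<noteq> 0 \<longrightarrow>
        f j = Suc (f i) \<and> B $ i $ j = 1 \<and> B $ i $ i = B $ j $ j))"

definition jordan_form_of :: "complex^'n^'n \<Rightarrow> complex^'n^'n \<Rightarrow> bool" where
  "jordan_form_of A B \<longleftrightarrow>
     jordan_matrix B \<and> (\<exists>P. invertible P \<and> A = P ** B ** matrix_inv P)"

text \<open>The part of every Jordan form that belongs to \<open>\<mu>\<close> is a diagonal matrix.\<close>

definition jordan_block_diagonal :: "complex^'n^'n \<Rightarrow> complex \<Rightarrow> bool" where
  "jordan_block_diagonal A \<mu> \<longleftrightarrow> (\<forall>B. jordan_form_of A B \<longrightarrow>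
     (\<forall>i j. B $ i $ i = \<mu> \<longrightarrow> B $ j $ j = \<mu> \<longrightarrow> i \<noteq> j \<longrightarrow> B $ i $ j = 0))"

definition Q_inner :: "real^'n^'n \<Rightarrow> real^'n \<Rightarrow> real^'n \<Rightarrow> real" where
  "Q_inner Q x y = (Q *v x) \<bullet> y"

definition Q_orth_decomp ::
  "real^'n^'n \<Rightarrow> (real^'n) set \<Rightarrow> (real^'n) set \<Rightarrow> bool" where
  "Q_orth_decomp Q M1 M2 \<longleftrightarrow> subspace M1 \<and> subspace M2 \<and>
     (\<forall>z. \<exists>x\<in>M1. \<exists>y\<in>M2. z = x + y) \<and> M1 \<inter> M2 = {0} \<and>
     (\<forall>x\<in>M1. \<forall>y\<in>M2. Q_inner Q x y = 0)"

definition endomorphism_on :: "(real^'n) set \<Rightarrow> (real^'n \<Rightarrow> real^'n) \<Rightarrow> bool" where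
  "endomorphism_on M T \<longleftrightarrow> (\<forall>x\<in>M. T x \<in> M) \<and>
     (\<forall>x\<in>M. \<forall>y\<in>M. T (x + y) = T x + T y) \<and> (\<forall>c. \<forall>x\<in>M. T (c *\<^sub>R x) = c *\<^sub>R T x)"

text \<open>With respect to the direct sum of \<open>M1\<close> and \<open>M2\<close>, the matrix \<open>A\<close> has the diagonal
  blocks \<open>T1\<close> and \<open>T2\<close> and zero off-diagonal blocks. The values of \<open>T1\<close> and \<open>T2\<close>
  outside \<open>M1\<close> and \<open>M2\<close> are irrelevant.\<close>

definition block_diag_on ::
  "(real^'n) set \<Rightarrow> (real^'n) set \<Rightarrow> real^'n^'n \<Rightarrow>
   (real^'n \<Rightarrow> real^'n) \<Rightarrow> (real^'n \<Rightarrow> real^'n) \<Rightarrow> bool" where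
  "block_diag_on M1 M2 A T1 T2 \<longleftrightarrow> endomorphism_on M1 T1 \<and> endomorphism_on M2 T2 \<and>
     (\<forall>x\<in>M1. \<forall>y\<in>M2. A *v (x + y) = T1 x + T2 y)"

definition Q_skew_symmetric_on ::
  "real^'n^'n \<Rightarrow> (real^'n) set \<Rightarrow> (real^'n \<Rightarrow> real^'n) \<Rightarrow> bool" where
  "Q_skew_symmetric_on Q M T \<longleftrightarrow>
     (\<forall>x\<in>M. \<forall>y\<in>M. Q_inner Q (T x) y = - Q_inner Q x (T y))"

definition Q_pos_semidef_on ::
  "real^'n^'n \<Rightarrow> (real^'n) set \<Rightarrow> (real^'n \<Rightarrow> real^'n) \<Rightarrow> bool" where
  "Q_pos_semidef_on Q M T \<longleftrightarrow>
     (\<forall>x\<in>M. \<forall>y\<in>M. Q_inner Q (T x) y = Q_inner Q x (T y)) \<and>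
     (\<forall>x\<in>M. 0 \<le> Q_inner Q (T x) x)"

text \<open>Complex eigenvalues of a real endomorphism \<open>T\<close> of \<open>M\<close>, i.e. of its
  complexification \<open>x + i y \<mapsto> T x + i T y\<close> on \<open>M + i M\<close>.\<close>

definition eigenvalues_on :: "(real^'n) set \<Rightarrow> (real^'n \<Rightarrow> real^'n) \<Rightarrow> complex set" where
  "eigenvalues_on M T = {\<mu>. \<exists>z. z \<noteq> 0 \<and> Re_vec z \<in> M \<and> Im_vec z \<in> M \<and>
     (\<chi> k. Complex (T (Re_vec z) $ k) (T (Im_vec z) $ k)) = \<mu> *s z}"

definition Hurwitz_on :: "(real^'n) set \<Rightarrow> (real^'n \<Rightarrow> real^'n) \<Rightarrow> bool" where
  "Hurwitz_on M T \<longleftrightarrow> (\<forall>\<mu>\<in>eigenvalues_on M T. Re \<mu> < 0)"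

end

theory Submission
  imports Defs
begin

text \<open>Write \<open>K = J Q\<close>, \<open>S = R Q\<close> and \<open>\<langle>x, y\<rangle> = Q x \<bullet> y\<close>. Then \<open>K\<close> is skew and \<open>S\<close> is
  positive semidefinite for this inner product, so the real part of an eigenvalue of
  \<open>A = K - S\<close> has the sign of \<open>- \<langle>S x, x\<rangle> - \<langle>S y, y\<rangle>\<close>, where \<open>x + i y\<close> is an eigenvector. If it
  vanishes, then \<open>S\<close> annihilates \<open>x\<close> and \<open>y\<close>, so \<open>x + i y\<close> is an eigenvector of \<open>K\<close> and of the
  adjoint \<open>- K - S\<close>. Hence \<open>ker (A - i\<alpha>)\<close> is orthogonal to the range of \<open>A - i\<alpha>\<close>, which excludes
  Jordan chains. For the decomposition, \<open>M1\<close> is spanned by the real and imaginary parts of all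
  eigenvectors to imaginary eigenvalues, and \<open>M2\<close> is its \<open>Q\<close>-orthogonal complement. An eigenvector
  in \<open>M2\<close> to an imaginary eigenvalue would also lie in \<open>M1\<close>.\<close>

section \<open>Real and imaginary parts of complex vectors\<close>

lemma complex_vec_eq_iff: "z = w \<longleftrightarrow> Re_vec z = Re_vec w \<and> Im_vec z = Im_vec w"
  by (auto simp: Re_vec_def Im_vec_def vec_eq_iff complex_eq_iff)

lemma Re_vec_zero [simp]: "Re_vec 0 = 0" and Im_vec_zero [simp]: "Im_vec 0 = 0"
  by (simp_all add: Re_vec_def Im_vec_def vec_eq_iff)

lemma Re_vec_diff: "Re_vec (z - w) = Re_vec z - Re_vec w"
  and Im_vec_diff: "Im_vec (z - w) = Im_vec z - Im_vec w"
  by (simp_all add: Re_vec_def Im_vec_def vec_eq_iff)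

lemma Re_vec_scale: "Re_vec (c *s z) = Re c *\<^sub>R Re_vec z - Im c *\<^sub>R Im_vec z"
  and Im_vec_scale: "Im_vec (c *s z) = Im c *\<^sub>R Re_vec z + Re c *\<^sub>R Im_vec z"
  by (simp_all add: Re_vec_def Im_vec_def vec_eq_iff)

lemma Re_vec_Complex: "Re_vec (\<chi> k. Complex (x $ k) (y $ k)) = x"
  and Im_vec_Complex: "Im_vec (\<chi> k. Complex (x $ k) (y $ k)) = y"
  by (simp_all add: Re_vec_def Im_vec_def vec_eq_iff)

lemma Re_vec_cmat_mult: "Re_vec (cmat A *v z) = A *v Re_vec z"
  and Im_vec_cmat_mult: "Im_vec (cmat A *v z) = A *v Im_vec z"
  by (simp_all add: Re_vec_def Im_vec_def vec_eq_iff cmat_def map_matrix_def matrix_vector_mult_def)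

lemma mat_mult_vec: "mat c *v x = c *s (x :: 'a::comm_ring_1^'n)"
  by (simp add: vec_eq_iff matrix_vector_mult_def mat_def if_distrib if_distribR cong: if_cong)

text \<open>Passing to a pair of real equations lets all later estimates use the real inner product
  instead of a Hermitian form.\<close>

lemma cmat_eigenvector_iff:
  "cmat A *v z = \<mu> *s z \<longleftrightarrow>
     A *v Re_vec z = Re \<mu> *\<^sub>R Re_vec z - Im \<mu> *\<^sub>R Im_vec z \<and>
     A *v Im_vec z = Im \<mu> *\<^sub>R Re_vec z + Re \<mu> *\<^sub>R Im_vec z"
  by (simp add: complex_vec_eq_iff Re_vec_cmat_mult Im_vec_cmat_mult Re_vec_scale Im_vec_scale)

lemma mem_ker_diff_mat_iff: "z \<in> ker (B - mat \<mu>) \<longleftrightarrow> B *v z = \<mu> *s z"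
  by (simp add: ker_def matrix_vector_mult_diff_rdistrib mat_mult_vec)

lemma mem_ker_imaginary_iff:
  "z \<in> ker (cmat B - mat (\<i> * complex_of_real \<alpha>)) \<longleftrightarrow>
     B *v Re_vec z = - (\<alpha> *\<^sub>R Im_vec z) \<and> B *v Im_vec z = \<alpha> *\<^sub>R Re_vec z"
  by (simp add: mem_ker_diff_mat_iff cmat_eigenvector_iff)

section \<open>Jordan chains and kernels of squares\<close>

lemma mem_ker_square_iff: "z \<in> ker (B ** B) \<longleftrightarrow> B *v z \<in> ker B"
  by (simp add: ker_def matrix_vector_mul_assoc)

text \<open>A superdiagonal entry in column \<open>q\<close> and row \<open>p\<close> links the
  basis vectors of \<open>p\<close> and \<open>q\<close>. If \<open>q\<close> is the first such
  column for \<open>\<mu>\<close>, the basis vector of \<open>p\<close> is an eigenvector.\<close>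

lemma jordan_matrix_chain:
  fixes B :: "complex^'n^'n"
  assumes "jordan_matrix B" "B $ i $ j \<noteq> 0" "i \<noteq> j" "B $ j $ j = \<mu>"
  obtains v w where "v \<noteq> 0" "B *v v = \<mu> *s v" "B *v w = \<mu> *s w + v"
proof -
  obtain f :: "'n \<Rightarrow> nat" where bij: "bij_betw f UNIV {..<CARD('n)}"
    and f: "\<And>i j. i \<noteq> j \<Longrightarrow> B $ i $ j \<noteq> 0 \<Longrightarrow>
        f j = Suc (f i) \<and> B $ i $ j = 1 \<and> B $ i $ i = B $ j $ j"
    using assms(1) unfolding jordan_matrix_def by blast
  have inj: "f a = f b \<Longrightarrow> a = b" for a b
    using bij by (auto simp: bij_betw_def dest: injD)
  \<comment> \<open>The start of a Jordan chain: the superdiagonal entry 1 of smallest index.\<close>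
  define P where "P = (\<lambda>j. B $ j $ j = \<mu> \<and> (\<exists>i. i \<noteq> j \<and> B $ i $ j \<noteq> 0))"
  have "P j" using assms by (auto simp: P_def)
  then obtain q where q: "P q" and least: "\<And>r. P r \<Longrightarrow> f q \<le> f r"
    using ex_has_least_nat[of P j f] by auto
  then obtain p where p: "p \<noteq> q" "B $ p $ q \<noteq> 0" and Bq: "B $ q $ q = \<mu>"
    by (auto simp: P_def)
  note pq = f[OF p]
  have Bp: "B $ p $ p = \<mu>" using pq Bq by simp
  have col: "B *v axis k 1 = (\<chi> r. B $ r $ k)" for k
    by (simp add: vec_eq_iff matrix_vector_mult_def axis_def if_distrib cong: if_cong)
  \<comment> \<open>\<open>p\<close> directly precedes \<open>q\<close>, so minimality of
    \<open>q\<close> clears column \<open>p\<close> off the diagonal.\<close>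
  have "\<not> P p" using least[of p] pq by auto
  then have zp: "B $ r $ p = 0" if "r \<noteq> p" for r
    using that Bp by (auto simp: P_def)
  \<comment> \<open>Another nonzero entry in column \<open>q\<close> would lie in a row with the
    same index under \<open>f\<close> as \<open>p\<close>.\<close>
  have zq: "B $ r $ q = 0" if "r \<noteq> p" "r \<noteq> q" for r
    using that f[of r q] pq inj[of r p] by (metis nat.inject)
  show ?thesis
  proof
    show "axis p 1 \<noteq> (0 :: complex^'n)" by simp
    show "B *v axis p 1 = \<mu> *s axis p 1"
      using zp Bp unfolding col by (auto simp: vec_eq_iff axis_def)
    show "B *v axis q 1 = \<mu> *s axis q 1 + axis p 1"
      using zq Bq pq p unfolding col by (auto simp: vec_eq_iff axis_def)
  qed
qed

text \<open>A nonzero off-diagonal entry yields a chain \<open>v\<close>, \<open>w\<close> of the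
  Jordan matrix. The similarity \<open>P\<close> carries it to a chain of \<open>B\<close>, whose
  second vector lies in the kernel of the square but not in the kernel.\<close>

lemma jordan_block_diagonal_if_ker_square:
  assumes "ker ((B - mat \<mu>) ** (B - mat \<mu>)) \<subseteq> ker (B - mat \<mu>)"
  shows "jordan_block_diagonal B \<mu>"
  unfolding jordan_block_diagonal_def
proof (intro allI impI, rule ccontr)
  fix C i j
  assume C: "jordan_form_of B C" and d: "C $ i $ i = \<mu>" "C $ j $ j = \<mu>" "i \<noteq> j" "C $ i $ j \<noteq> 0"
  obtain P where P: "invertible P" "B = P ** C ** matrix_inv P" and "jordan_matrix C"
    using C by (auto simp: jordan_form_of_def)
  then obtain v w where vw: "v \<noteq> 0" "C *v v = \<mu> *s v" "C *v w = \<mu> *s w + v"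
    using d jordan_matrix_chain by metis
  have inv: "matrix_inv P ** P = mat 1" 
    using P(1) unfolding invertible_def matrix_inv_def by (rule someI2_ex) simp
  have "B ** P = P ** C"
    using inv by (simp add: P(2) flip: matrix_mul_assoc)
  then have BP: "B *v (P *v x) = P *v (C *v x)" for x
    by (simp add: matrix_vector_mul_assoc)
  have v: "P *v v \<in> ker (B - mat \<mu>)"
    by (simp add: mem_ker_diff_mat_iff BP vw vector_scalar_commute)
  have w: "(B - mat \<mu>) *v (P *v w) = P *v v"
    by (simp add: matrix_vector_mult_diff_rdistrib mat_mult_vec BP vw
        matrix_vector_right_distrib vector_scalar_commute)
  have "P *v w \<in> ker (B - mat \<mu>)"
    using v w assms by (auto simp: mem_ker_square_iff)
  then have "P *v v = 0" using w by (simp add: ker_def)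
  then have "matrix_inv P *v (P *v v) = 0" by simp
  then show False using vw(1) inv by (simp add: matrix_vector_mul_assoc)
qed

section \<open>Semidefinite forms\<close>

lemma inner_mult_transpose: "((B :: real^'n^'m) *v x) \<bullet> y = x \<bullet> (transpose B *v y)"
  by (metis dot_lmul_matrix inner_commute vector_transpose_matrix)

text \<open>Along the line \<open>x + t *\<^sub>R v\<close> with \<open>v = R *v x\<close> the form
  is a nonnegative quadratic polynomial in \<open>t\<close> without constant term, so its linear
  coefficient \<open>2 * (v \<bullet> v)\<close> must vanish.\<close>

lemma pos_semidef_form_zero:
  assumes "sym_pos_semidef R" "(R *v x) \<bullet> x = 0"
  shows "R *v x = 0"
proof -
  define v where "v = R *v x"
  have sym: "(R *v v) \<bullet> x = v \<bullet> v"
    using assms(1) by (simp add: sym_pos_semidef_def inner_mult_transpose v_def)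
  have q: "0 \<le> t\<^sup>2 * ((R *v v) \<bullet> v) + 2 * t * (v \<bullet> v)" for t :: real
  proof -
    have "0 \<le> (R *v (x + t *\<^sub>R v)) \<bullet> (x + t *\<^sub>R v)"
      using assms(1) by (simp add: sym_pos_semidef_def)
    also have "\<dots> = t\<^sup>2 * ((R *v v) \<bullet> v) + 2 * t * (v \<bullet> v)"
      using assms(2) sym
      by (simp add: matrix_vector_right_distrib matrix_vector_mult_scaleR inner_add_left
          inner_add_right power2_eq_square algebra_simps flip: v_def)
    finally show ?thesis .
  qed
  have c: "0 \<le> (R *v v) \<bullet> v" using assms(1) by (simp add: sym_pos_semidef_def)
  have "v \<bullet> v \<le> 0"
  proof (rule ccontr)
    assume "\<not> v \<bullet> v \<le> 0"
    then have pos: "0 < v \<bullet> v" by linarith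
    \<comment> \<open>The form is evaluated at \<open>- t\<close>. The summand 1 keeps the
      denominator positive, and \<open>t * ((R *v v) \<bullet> v)\<close> stays below
      \<open>v \<bullet> v\<close>.\<close>
    define t where "t = (v \<bullet> v) / ((R *v v) \<bullet> v + 1)"
    have t: "0 < t" "t * ((R *v v) \<bullet> v + 1) = v \<bullet> v"
      using pos c by (simp_all add: t_def add_nonneg_pos)
    have "0 \<le> t * (t * ((R *v v) \<bullet> v) - 2 * (v \<bullet> v))"
      using q[of "- t"] by (simp add: power2_eq_square algebra_simps)
    then have "0 \<le> t * ((R *v v) \<bullet> v) - 2 * (v \<bullet> v)"
      using t(1) by (simp add: zero_le_mult_iff)
    then show False using t pos by (simp add: algebra_simps)
  qed
  then have "v \<bullet> v = 0" by (simp only: order_antisym inner_ge_zero)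
  then show ?thesis by (simp add: v_def)
qed

section \<open>The inner product given by \<open>Q\<close>\<close>

locale dissipative =
  fixes J R Q :: "real^'n^'n"
  assumes J: "skew_symmetric J" and R: "sym_pos_semidef R" and Q: "sym_pos_def Q"
begin

abbreviation K where "K \<equiv> J ** Q"
abbreviation S where "S \<equiv> R ** Q"
abbreviation A where "A \<equiv> (J - R) ** Q"
abbreviation form where "form \<equiv> Q_inner Q"

lemma A_apply: "A *v x = K *v x - S *v x"
  by (simp add: matrix_vector_mult_diff_rdistrib flip: matrix_vector_mul_assoc)

lemma form_linear:
  "form (x + y) z = form x z + form y z" "form (x - y) z = form x z - form y z"
  "form (c *\<^sub>R x) z = c * form x z" "form (- x) z = - form x z" "form 0 z = 0"
  "form z (x + y) = form z x + form z y" "form z (x - y) = form z x - form z y"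
  "form z (c *\<^sub>R x) = c * form z x" "form z (- x) = - form z x" "form z 0 = 0"
  unfolding Q_inner_def
  by (simp_all add: matrix_vector_right_distrib matrix_vector_mult_diff_distrib
      matrix_vector_mult_scaleR inner_add_left inner_add_right inner_diff_left inner_diff_right
      linear_neg[OF matrix_vector_mul_linear])

lemma Q_symmetric: "(Q *v x) \<bullet> y = x \<bullet> (Q *v y)"
  using Q by (simp add: sym_pos_def_def inner_mult_transpose)

lemma form_commute: "form x y = form y x"
  by (simp add: Q_inner_def Q_symmetric inner_commute[of x])

lemma form_pos: "x \<noteq> 0 \<Longrightarrow> 0 < form x x"
  using Q by (simp add: sym_pos_def_def Q_inner_def)

lemma form_nonneg: "0 \<le> form x x"
  using form_pos[of x] by (cases "x = 0") (auto simp: form_linear)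

lemma form_sum_zero: "form x x + form y y = 0 \<Longrightarrow> x = 0 \<and> y = 0"
  using form_pos[of x] form_pos[of y] form_nonneg[of x] form_nonneg[of y] by fastforce

text \<open>Reduces properties of \<open>K\<close> and \<open>S\<close> for \<open>form\<close> to
  those of \<open>J\<close> and \<open>R\<close> for the Euclidean inner product, at the vectors
  \<open>Q *v x\<close> and \<open>Q *v y\<close>.\<close>

lemma form_mult: "form ((B ** Q) *v x) y = (B *v (Q *v x)) \<bullet> (Q *v y)"
  by (simp add: Q_inner_def Q_symmetric flip: matrix_vector_mul_assoc)

lemma K_skew: "form (K *v x) y = - form x (K *v y)"
proof -
  have "(J *v u) \<bullet> v = - ((J *v v) \<bullet> u)" for u v
    using J by (simp add: skew_symmetric_def inner_mult_transpose[of J u v]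
        inner_commute[of "J *v v"]
        matrix_vector_mult_diff_rdistrib[of 0 J, simplified])
  then show ?thesis unfolding form_commute[of x] form_mult .
qed

lemma S_symmetric: "form (S *v x) y = form x (S *v y)"
proof -
  have "(R *v u) \<bullet> v = (R *v v) \<bullet> u" for u v
    using R by (simp add: sym_pos_semidef_def inner_mult_transpose[of R u v] inner_commute[of u])
  then show ?thesis unfolding form_commute[of x] form_mult .
qed

lemma S_nonneg: "0 \<le> form (S *v x) x"
  using R by (simp add: form_mult sym_pos_semidef_def)

lemma S_form_zero: "form (S *v x) x = 0 \<Longrightarrow> S *v x = 0"
  unfolding form_mult using pos_semidef_form_zero[OF R] by (simp flip: matrix_vector_mul_assoc)

lemma K_form_zero: "form (K *v x) x = 0"
  using K_skew[of x x] form_commute[of x] by simp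

section \<open>Eigenvectors and the imaginary axis\<close>

lemma eigenvector_balance:
  assumes "A *v x = a *\<^sub>R x - b *\<^sub>R y" "A *v y = b *\<^sub>R x + a *\<^sub>R y"
  shows "a * (form x x + form y y) = - form (S *v x) x - form (S *v y) y"
proof -
  \<comment> \<open>The two terms with factor \<open>b\<close> cancel by symmetry of
    \<open>form\<close>.\<close>
  have "form (A *v x) x + form (A *v y) y = a * (form x x + form y y)"
    by (simp add: assms form_linear form_commute[of y x] algebra_simps)
  then show ?thesis by (simp add: A_apply form_linear K_form_zero)
qed

lemma eigenvector_Re_nonpos:
  assumes "A *v x = a *\<^sub>R x - b *\<^sub>R y" "A *v y = b *\<^sub>R x + a *\<^sub>R y" "x \<noteq> 0 \<or> y \<noteq> 0"
  shows "a \<le> 0"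
proof -
  have "0 < form x x + form y y"
    using assms(3) form_sum_zero[of x y] form_nonneg[of x] form_nonneg[of y] by fastforce
  moreover have "a * (form x x + form y y) \<le> 0"
    using eigenvector_balance[OF assms(1,2)] S_nonneg[of x] S_nonneg[of y] by simp
  ultimately show ?thesis by (simp add: mult_le_0_iff)
qed

text \<open>For \<open>a = 0\<close> the balance leaves two nonnegative terms with sum zero.\<close>

lemma imaginary_eigenvector:
  assumes "A *v x = - (b *\<^sub>R y)" "A *v y = b *\<^sub>R x"
  shows "S *v x = 0" "S *v y = 0" "K *v x = - (b *\<^sub>R y)" "K *v y = b *\<^sub>R x"
proof -
  have "form (S *v x) x = 0" "form (S *v y) y = 0"
    using eigenvector_balance[of x 0 b y] assms S_nonneg[of x] S_nonneg[of y] by simp_all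
  then show S: "S *v x = 0" "S *v y = 0" by (auto intro: S_form_zero)
  show "K *v x = - (b *\<^sub>R y)" "K *v y = b *\<^sub>R x"
    using assms S by (simp_all add: A_apply)
qed

lemma ker_square_imaginary:
  "ker (cmat A - mat (\<i> * complex_of_real \<alpha>)) =
   ker ((cmat A - mat (\<i> * complex_of_real \<alpha>)) ** (cmat A - mat (\<i> * complex_of_real \<alpha>)))"
  (is "ker ?B = _")
proof (intro equalityI subsetI)
  fix z assume "z \<in> ker ?B"
  then show "z \<in> ker (?B ** ?B)" by (simp add: mem_ker_square_iff) (simp add: ker_def)
next
  fix z assume "z \<in> ker (?B ** ?B)"
  then have w: "?B *v z \<in> ker ?B" by (simp add: mem_ker_square_iff)
  define u v where "u = Re_vec (?B *v z)" and "v = Im_vec (?B *v z)"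
  define x y where "x = Re_vec z" and "y = Im_vec z"
  have u: "u = A *v x + \<alpha> *\<^sub>R y" and v: "v = A *v y - \<alpha> *\<^sub>R x"
    by (simp_all add: u_def v_def x_def y_def matrix_vector_mult_diff_rdistrib mat_mult_vec
        Re_vec_diff Im_vec_diff Re_vec_cmat_mult Im_vec_cmat_mult Re_vec_scale Im_vec_scale)
  have "A *v u = - (\<alpha> *\<^sub>R v)" "A *v v = \<alpha> *\<^sub>R u"
    using w by (simp_all only: mem_ker_imaginary_iff u_def v_def)
  note im = imaginary_eigenvector[OF this]
  \<comment> \<open>\<open>K\<close> and \<open>S\<close> are moved to the second argument, where
    \<open>im\<close> gives their values on \<open>u\<close> and \<open>v\<close>.\<close>
  have "form (A *v x) u = \<alpha> * form x v" "form (A *v y) v = - \<alpha> * form y u"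
    by (simp_all add: A_apply form_linear K_skew S_symmetric im)
  then have "form u u + form v v = 0"
    by (subst (1) u, subst (2) v) (simp add: form_linear form_commute[of v])
  then have "u = 0 \<and> v = 0" by (rule form_sum_zero)
  then have "?B *v z = 0" by (simp add: complex_vec_eq_iff u_def v_def)
  then show "z \<in> ker ?B" by (simp add: ker_def)
qed

lemma N_space_imaginary_subset:
  "N_space (\<i> * complex_of_real \<alpha>) A \<subseteq> N_space (\<i> * complex_of_real \<alpha>) K \<inter> ker S"
proof -
  let ?N = "N_space (\<i> * complex_of_real \<alpha>) K \<inter> ker S"
  have "subspace (ker S)"
    by (auto simp: ker_def subspace_def matrix_vector_right_distrib matrix_vector_mult_scaleR)
  then have sub: "subspace ?N"
    by (auto simp: N_space_def intro: subspace_inter)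
  have "Re_vec z \<in> ?N \<and> Im_vec z \<in> ?N"
    if "z \<in> ker (cmat A - mat (\<i> * complex_of_real \<alpha>))" for z
  proof -
    have "A *v Re_vec z = - (\<alpha> *\<^sub>R Im_vec z)" "A *v Im_vec z = \<alpha> *\<^sub>R Re_vec z"
      using that by (simp_all only: mem_ker_imaginary_iff)
    note im = imaginary_eigenvector[OF this]
    have "z \<in> ker (cmat K - mat (\<i> * complex_of_real \<alpha>))"
      unfolding mem_ker_imaginary_iff using im by simp
    then show ?thesis
      using im(1,2) by (auto simp: N_space_def ker_def[of S] intro!: span_base)
  qed
  then show ?thesis
    unfolding N_space_def[of _ A] by (intro span_minimal[OF _ sub]) auto
qed

section \<open>The orthogonal splitting\<close>

definition M1 where
  "M1 = span {x. \<exists>y b. A *v x = - (b *\<^sub>R y) \<and> A *v y = b *\<^sub>R x}"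

definition M2 where "M2 = {y. \<forall>x\<in>M1. form x y = 0}"

text \<open>The generators of \<open>M1\<close> are the real parts of eigenvectors
  \<open>x + i y\<close> to \<open>i b\<close>. Imaginary parts are among them, since
  \<open>y + i x\<close> is \<open>i\<close> times the conjugate vector and belongs to
  \<open>- i b\<close>.\<close>

lemma M1_base:
  assumes "A *v x = - (b *\<^sub>R y)" "A *v y = b *\<^sub>R x"
  shows "x \<in> M1" "y \<in> M1"
proof -
  show "x \<in> M1" unfolding M1_def by (rule span_base) (use assms in blast)
  have "A *v y = - ((- b) *\<^sub>R x)" "A *v x = (- b) *\<^sub>R y" using assms by simp_all
  then show "y \<in> M1" unfolding M1_def by (intro span_base) blast
qed

lemma M1_subspace: "subspace M1"
  by (simp add: M1_def)

lemma M1_invariant: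
  assumes "x \<in> M1"
  shows "K *v x \<in> M1" "S *v x = 0"
proof -
  let ?U = "{x. K *v x \<in> M1 \<and> S *v x = 0}"
  have "subspace ?U"
    using M1_subspace
    by (auto simp: subspace_def matrix_vector_right_distrib matrix_vector_mult_scaleR)
  moreover have "x \<in> ?U" if xy: "A *v x = - (b *\<^sub>R y)" "A *v y = b *\<^sub>R x" for x y b
    using imaginary_eigenvector[OF xy] M1_base(2)[OF xy]
    by (auto intro: subspace_neg subspace_scale M1_subspace)
  ultimately have "M1 \<subseteq> ?U"
    by (subst M1_def, intro span_minimal) blast+
  with assms have "x \<in> ?U" by blast
  then show "K *v x \<in> M1" "S *v x = 0" by auto
qed

lemma M2_subspace: "subspace M2"
  by (auto simp: M2_def subspace_def form_linear)

text \<open>A skew or symmetric map that preserves \<open>M1\<close> also preserves its orthogonal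
  complement.\<close>

lemma M2_invariant:
  assumes "y \<in> M2"
  shows "K *v y \<in> M2" "S *v y \<in> M2"
proof -
  show "K *v y \<in> M2"
    unfolding M2_def
  proof (intro CollectI ballI)
    fix x assume "x \<in> M1"
    then have "form (K *v x) y = 0" using M1_invariant assms by (simp add: M2_def)
    then show "form x (K *v y) = 0" by (simp add: K_skew)
  qed
  show "S *v y \<in> M2"
    by (simp add: M2_def S_symmetric[symmetric] M1_invariant form_linear)
qed

lemma M1_Int_M2: "M1 \<inter> M2 = {0}"
  using form_pos subspace_0[OF M1_subspace] subspace_0[OF M2_subspace]
  by (force simp: M2_def)

text \<open>\<open>M2\<close> is the Euclidean complement of the image of \<open>M1\<close> under
  \<open>Q\<close>. As \<open>Q\<close> is injective, the dimensions of \<open>M1\<close> and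
  \<open>M2\<close> add up to that of the whole space.\<close>

lemma Q_orth_decomp_M1_M2: "Q_orth_decomp Q M1 M2"
proof -
  have inj: "inj ((*v) Q)"
  proof (rule injI)
    fix x y assume "Q *v x = Q *v y"
    then have "form (x - y) (x - y) = 0" by (simp add: Q_inner_def matrix_vector_mult_diff_distrib)
    then show "x = y" using form_pos[of "x - y"] by auto
  qed
  let ?QM = "(*v) Q ` M1"
  have sub: "subspace ?QM"
    by (intro linear_subspace_image matrix_vector_mul_linear M1_subspace)
  have M2: "M2 = {y \<in> UNIV. \<forall>x\<in>?QM. orthogonal x y}"
    by (auto simp: M2_def Q_inner_def orthogonal_def)
  have "dim M2 + dim ?QM = dim (UNIV :: (real^'n) set)"
    unfolding M2 by (rule dim_subspace_orthogonal_to_vectors) (simp_all add: sub)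
  moreover have "dim ?QM = dim M1"
    by (rule dim_image_eq) (auto intro: inj inj_on_subset)
  moreover have "dim {x + y |x y. x \<in> M1 \<and> y \<in> M2} + dim (M1 \<inter> M2) = dim M1 + dim M2"
    by (rule dim_sums_Int[OF M1_subspace M2_subspace])
  ultimately have "dim {x + y |x y. x \<in> M1 \<and> y \<in> M2} = dim (UNIV :: (real^'n) set)"
    by (simp add: M1_Int_M2)
  then have "{x + y |x y. x \<in> M1 \<and> y \<in> M2} = UNIV"
    by (intro subspace_dim_equal subspace_sums M1_subspace M2_subspace) auto
  then have "\<exists>x\<in>M1. \<exists>y\<in>M2. z = x + y" for z by blast
  then show ?thesis
    using M1_subspace M2_subspace M1_Int_M2 by (auto simp: Q_orth_decomp_def M2_def)
qed

lemma Hurwitz_on_M2: "Hurwitz_on M2 (\<lambda>x. K *v x - S *v x)"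
  unfolding Hurwitz_on_def
proof
  fix \<mu> assume "\<mu> \<in> eigenvalues_on M2 (\<lambda>x. K *v x - S *v x)"
  then obtain z where z: "z \<noteq> 0" "Re_vec z \<in> M2" "Im_vec z \<in> M2"
    and ev: "(\<chi> k. Complex ((A *v Re_vec z) $ k) ((A *v Im_vec z) $ k)) = \<mu> *s z"
    by (auto simp: eigenvalues_on_def A_apply)
  have ev': "A *v Re_vec z = Re \<mu> *\<^sub>R Re_vec z - Im \<mu> *\<^sub>R Im_vec z"
    "A *v Im_vec z = Im \<mu> *\<^sub>R Re_vec z + Re \<mu> *\<^sub>R Im_vec z"
    using ev unfolding complex_vec_eq_iff Re_vec_Complex Im_vec_Complex Re_vec_scale Im_vec_scale
    by auto
  have nz: "Re_vec z \<noteq> 0 \<or> Im_vec z \<noteq> 0" using z(1) complex_vec_eq_iff[of z 0] by simp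
  have "Re \<mu> \<noteq> 0"
  proof
    assume "Re \<mu> = 0"
    then have "Re_vec z \<in> M1" "Im_vec z \<in> M1"
      using M1_base[of "Re_vec z" "Im \<mu>" "Im_vec z"] ev' by simp_all
    then show False using z nz M1_Int_M2 by blast
  qed
  then show "Re \<mu> < 0" using eigenvector_Re_nonpos[OF ev' nz] by simp
qed

lemma block_diag_on_invariant:
  assumes "\<And>x. x \<in> M1 \<Longrightarrow> B *v x \<in> M1" "\<And>x. x \<in> M2 \<Longrightarrow> B *v x \<in> M2"
  shows "block_diag_on M1 M2 B ((*v) B) ((*v) B)"
  using assms by (simp add: block_diag_on_def endomorphism_on_def matrix_vector_right_distrib
      matrix_vector_mult_scaleR)

end

theorem lemma2:
  fixes J R Q A :: "real^'n^'n"
  assumes "skew_symmetric J"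
    and "sym_pos_semidef R"
    and "sym_pos_def Q"
    and "A = (J - R) ** Q"
  shows "(\<forall>\<mu>\<in>eigenvalues A. Re \<mu> \<le> 0) \<and>
    (\<forall>\<alpha>::real.
       ker (cmat A - mat (\<i> * complex_of_real \<alpha>)) =
         ker ((cmat A - mat (\<i> * complex_of_real \<alpha>)) ** (cmat A - mat (\<i> * complex_of_real \<alpha>))) \<and>
       (\<i> * complex_of_real \<alpha> \<in> eigenvalues A \<longrightarrow>
         jordan_block_diagonal (cmat A) (\<i> * complex_of_real \<alpha>)) \<and>
       N_space (\<i> * complex_of_real \<alpha>) A \<subseteq>
         N_space (\<i> * complex_of_real \<alpha>) (J ** Q) \<inter> ker (R ** Q)) \<and>
    (\<exists>M1 M2 J1 J2 R2.
       Q_orth_decomp Q M1 M2 \<and>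
       block_diag_on M1 M2 (J ** Q) J1 J2 \<and>
       block_diag_on M1 M2 (R ** Q) (\<lambda>_. 0) R2 \<and>
       Q_skew_symmetric_on Q M1 J1 \<and>
       Q_skew_symmetric_on Q M2 J2 \<and>
       Q_pos_semidef_on Q M2 R2 \<and>
       Hurwitz_on M2 (\<lambda>x. J2 x - R2 x))"
proof -
  interpret d: dissipative J R Q
    using assms(1-3) by unfold_locales
  have "Re \<mu> \<le> 0" if ev: "\<mu> \<in> eigenvalues A" for \<mu>
  proof -
    obtain z where "z \<noteq> 0" "cmat A *v z = \<mu> *s z"
      using ev by (auto simp: eigenvalues_def)
    then show ?thesis
      using d.eigenvector_Re_nonpos[of "Re_vec z" "Re \<mu>" "Im \<mu>" "Im_vec z"]
        complex_vec_eq_iff[of z 0]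
      by (simp add: assms(4) cmat_eigenvector_iff)
  qed
  moreover have "jordan_block_diagonal (cmat A) (\<i> * complex_of_real \<alpha>)" for \<alpha>
    by (rule jordan_block_diagonal_if_ker_square)
      (simp only: assms(4) d.ker_square_imaginary[symmetric] subset_refl)
  \<comment> \<open>The blocks \<open>J1\<close>, \<open>J2\<close> and \<open>R2\<close> are the
    full matrix maps, which count only through their values on the invariant subspaces.\<close>
  moreover have "block_diag_on d.M1 d.M2 (J ** Q) ((*v) (J ** Q)) ((*v) (J ** Q))"
    by (intro d.block_diag_on_invariant d.M1_invariant d.M2_invariant)
  moreover have "block_diag_on d.M1 d.M2 (R ** Q) (\<lambda>_. 0) ((*v) (R ** Q))"
    using d.M1_invariant d.M2_invariant subspace_0[OF d.M1_subspace]
    by (simp add: block_diag_on_def endomorphism_on_def matrix_vector_right_distrib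
        matrix_vector_mult_scaleR)
  moreover have "Q_skew_symmetric_on Q M ((*v) (J ** Q))" for M
    by (simp add: Q_skew_symmetric_on_def d.K_skew)
  moreover have "Q_pos_semidef_on Q d.M2 ((*v) (R ** Q))"
    using d.S_nonneg d.S_symmetric by (simp add: Q_pos_semidef_on_def)
  ultimately show ?thesis
    using d.ker_square_imaginary d.N_space_imaginary_subset d.Q_orth_decomp_M1_M2 d.Hurwitz_on_M2
    unfolding assms(4) by blast
qed

end
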